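(* If a formula $\varphi$ is provable in $\mathsf{H}\mathbf{EFL}$, then for every finite tree $\mathcal{T}$, every label $\alpha\in\mathcal{T}$ and every agent nominal $n$ not occurring in $\varphi$, the tree sequent $\stackrel{\mathcal{T}}{\Rightarrow}\alpha:@_n\varphi$ (with empty left side) is provable in $\mathsf{T}\mathbf{EFL}$.
   Context: Syntax. Disjoint countably infinite sets $\mathsf{Prop}$ and $\mathsf{Nom}$ (agent nominals). Formulas: $\varphi ::= n \mid p \mid \bot \mid \varphi\to\varphi \mid @_{n}\varphi \mid \mathsf{F}\varphi \mid \Box\varphi$; $\neg,\top,\land,\lor,\leftrightarrow$ usual abbreviations; $\langle\mathsf{F}\rangle\varphi:=\neg\mathsf{F}\neg\varphi$. $@$-prefixed formulas have the form $@_n\varphi$. $\varphi[m/k]$ replaces nominal $k$ by $m$ everywhere. Uniform substitutions map propositional variables to formulas and nominals to nominals. Tree sequents. Labels: natural numbers, and $\alpha\cdot_ni$ (an $n$-child of $\alpha$) for label $\alpha$, nominal $n$, $i\in\mathbb{N}$. A tree: set of labels containing exactly one natural number (root), closed under parents. Labelled formula: $\alpha:\psi$, $\psi$ $@$-prefixed. Tree sequent $\Gamma\stackrel{\mathcal{T}}{\Rightarrow}\Delta$: finite sets of labelled formulas, finite tree containing their labels. Calculus $\mathsf{T}\mathbf{EFL}$ ($\alpha,\beta\in\mathcal{T}$; tree unchanged unless indicated). Initial: $\alpha:@_n\bot,\Gamma\Rightarrow\Delta$; $\alpha:@_n\varphi,\Gamma\Rightarrow\Delta,\alpha:@_n\varphi$.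 Rules (premises / conclusion): $(\mathsf{rep}_{=1})$ $\alpha:@_nm,\alpha:\varphi[n/k],\Gamma\Rightarrow\Delta$ / $\alpha:@_nm,\alpha:\varphi[m/k],\Gamma\Rightarrow\Delta$; $(\mathsf{rep}_{=2})$ $\alpha:@_nm,\alpha:\varphi[m/k],\Gamma\Rightarrow\Delta$ / $\alpha:@_nm,\alpha:\varphi[n/k],\Gamma\Rightarrow\Delta$; $(\mathsf{ref}_=)$ $\alpha:@_nn,\Gamma\Rightarrow\Delta$ / $\Gamma\Rightarrow\Delta$; $(\mathsf{rigid}_=)$ $\beta:@_nm,\Gamma\Rightarrow\Delta$ / $\alpha:@_nm,\Gamma\Rightarrow\Delta$; $(\to R)$ $\alpha:@_n\varphi,\Gamma\Rightarrow\Delta,\alpha:@_n\psi$ / $\Gamma\Rightarrow\Delta,\alpha:@_n(\varphi\to\psi)$; $(\to L)$ $\Gamma\Rightarrow\Delta,\alpha:@_n\varphi$ and $\alpha:@_n\psi,\Gamma\Rightarrow\Delta$ / $\alpha:@_n(\varphi\to\psi),\Gamma\Rightarrow\Delta$; $(@R)$ $\Gamma\Rightarrow\Delta,\alpha:@_m\varphi$ / $\Gamma\Rightarrow\Delta,\alpha:@_n@_m\varphi$; $(@L)$ $\alpha:@_m\varphi,\Gamma\Rightarrow\Delta$ / $\alpha:@_n@_m\varphi,\Gamma\Rightarrow\Delta$; $(\mathsf{F}R)$ $\alpha:@_n\langle\mathsf{F}\rangle m,\Gamma\Rightarrow\Delta,\alpha:@_m\varphi$ / $\Gamma\Rightarrow\Delta,\alpha:@_n\mathsf{F}\varphi$,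 $m$ not in the conclusion; $(\mathsf{F}L)$ $\Gamma\Rightarrow\Delta,\alpha:@_n\langle\mathsf{F}\rangle m$ and $\alpha:@_m\varphi,\Gamma\Rightarrow\Delta$ / $\alpha:@_n\mathsf{F}\varphi,\Gamma\Rightarrow\Delta$; $(\Box R)$ $\Gamma\stackrel{\mathcal{T}\cup\{\alpha\cdot_ni\}}{\Rightarrow}\Delta,\alpha\cdot_ni:@_n\varphi$ / $\Gamma\stackrel{\mathcal{T}}{\Rightarrow}\Delta,\alpha:@_n\Box\varphi$, $i$ fresh in the conclusion; $(\Box L)$ $\beta:@_n\varphi,\Gamma\Rightarrow\Delta$ / $\alpha:@_n\Box\varphi,\Gamma\Rightarrow\Delta$, $\beta$ an $n$-child of $\alpha$; $(w\mathsf{lab})$ $\Gamma\stackrel{\mathcal{T}}{\Rightarrow}\Delta$ / $\Gamma\stackrel{\mathcal{T}\cup\{\alpha\}}{\Rightarrow}\Delta$ if $\mathcal{T}\cup\{\alpha\}$ is a tree; $(Cut)$ $\Gamma\Rightarrow\Delta,\alpha:@_n\varphi$ and $\alpha:@_n\varphi,\Pi\Rightarrow\Sigma$ / $\Gamma,\Pi\Rightarrow\Delta,\Sigma$. Hilbert system $\mathsf{H}\mathbf{EFL}$. Necessity forms: $\#$; $\varphi\to L$; $@_n\Box L$ for necessity form $L$; $L(\varphi)$ replaces $\#$ by $\varphi$. Axioms ($p,q\in\mathsf{Prop}$, $n,m\in\mathsf{Nom}$): propositional tautologies; $\Box(p\to q)\to(\Box p\to\Box q)$; $\mathsf{F}(p\to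 q)\to(\mathsf{F}p\to\mathsf{F}q)$; $@_n(p\to q)\to(@_np\to@_nq)$; $@_nn$; $\neg@_np\leftrightarrow@_n\neg p$; $@_np\to(n\to p)$; $@_n@_mp\to@_mp$; $@_np\to\mathsf{F}@_np$; $@_n\Box@_np\leftrightarrow@_n\Box p$; $@_nm\to\Box@_nm$; $\neg@_nm\to\Box\neg@_nm$. Rules: modus ponens; from $\varphi$ infer $\Box\varphi$, $\mathsf{F}\varphi$, $@_n\varphi$; uniform substitution; from $n\to\varphi$ infer $\varphi$ if $n$ does not occur in $\varphi$; from $L(@_n\langle\mathsf{F}\rangle m\to@_m\varphi)$ infer $L(@_n\mathsf{F}\varphi)$ if $m$ does not occur in $L(@_n\mathsf{F}\varphi)$. *)

theory Defs
  imports Main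
begin

section \<open>Syntax\<close>

datatype propvar = PropVar nat
datatype nominal = Nominal nat

datatype fm =
    Nom nominal
  | Var propvar
  | Bot
  | Imp fm fm  (infixr \<open>\<^bold>\<rightarrow>\<close> 55)
  | At nominal fm
  | F fm
  | Box fm

abbreviation Neg :: "fm \<Rightarrow> fm" where
  "Neg \<phi> \<equiv> \<phi> \<^bold>\<rightarrow> Bot"

abbreviation Conj :: "fm \<Rightarrow> fm \<Rightarrow> fm" where
  "Conj \<phi> \<psi> \<equiv> Neg (\<phi> \<^bold>\<rightarrow> Neg \<psi>)"

abbreviation Iff :: "fm \<Rightarrow> fm \<Rightarrow> fm" where
  "Iff \<phi> \<psi> \<equiv> Conj (\<phi> \<^bold>\<rightarrow> \<psi>) (\<psi> \<^bold>\<rightarrow> \<phi>)"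

abbreviation DiaF :: "fm \<Rightarrow> fm" where
  "DiaF \<phi> \<equiv> Neg (F (Neg \<phi>))"

definition at_prefixed :: "fm \<Rightarrow> bool" where
  "at_prefixed \<psi> \<longleftrightarrow> (\<exists>n \<phi>. \<psi> = At n \<phi>)"

primrec noms :: "fm \<Rightarrow> nominal set" where
  "noms (Nom n) = {n}"
| "noms (Var p) = {}"
| "noms Bot = {}"
| "noms (\<phi> \<^bold>\<rightarrow> \<psi>) = noms \<phi> \<union> noms \<psi>"
| "noms (At n \<phi>) = insert n (noms \<phi>)"
| "noms (F \<phi>) = noms \<phi>"
| "noms (Box \<phi>) = noms \<phi>"

primrec usubst :: "(propvar \<Rightarrow> fm) \<Rightarrow> (nominal \<Rightarrow> nominal) \<Rightarrow> fm \<Rightarrow> fm" where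
  "usubst \<sigma> \<rho> (Nom n) = Nom (\<rho> n)"
| "usubst \<sigma> \<rho> (Var p) = \<sigma> p"
| "usubst \<sigma> \<rho> Bot = Bot"
| "usubst \<sigma> \<rho> (\<phi> \<^bold>\<rightarrow> \<psi>) = usubst \<sigma> \<rho> \<phi> \<^bold>\<rightarrow> usubst \<sigma> \<rho> \<psi>"
| "usubst \<sigma> \<rho> (At n \<phi>) = At (\<rho> n) (usubst \<sigma> \<rho> \<phi>)"
| "usubst \<sigma> \<rho> (F \<phi>) = F (usubst \<sigma> \<rho> \<phi>)"
| "usubst \<sigma> \<rho> (Box \<phi>) = Box (usubst \<sigma> \<rho> \<phi>)"

definition subst_nom :: "fm \<Rightarrow> nominal \<Rightarrow> nominal \<Rightarrow> fm"  (\<open>_[_'/_]\<close> [1000, 0, 0] 1000) where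
  "\<phi>[m/k] = usubst Var (id(k := m)) \<phi>"


section \<open>Hilbert system\<close>

text \<open>Every formula that is not \<^term>\<open>Bot\<close> or an implication counts as a propositional atom,
  so the tautologies comprise all substitution instances of tautologies.\<close>

primrec tval :: "(fm \<Rightarrow> bool) \<Rightarrow> fm \<Rightarrow> bool" where
  "tval v (Nom n) = v (Nom n)"
| "tval v (Var p) = v (Var p)"
| "tval v Bot = False"
| "tval v (\<phi> \<^bold>\<rightarrow> \<psi>) = (tval v \<phi> \<longrightarrow> tval v \<psi>)"
| "tval v (At n \<phi>) = v (At n \<phi>)"
| "tval v (F \<phi>) = v (F \<phi>)"
| "tval v (Box \<phi>) = v (Box \<phi>)"

definition tautology :: "fm \<Rightarrow> bool" where
  "tautology \<phi> \<longleftrightarrow> (\<forall>v. tval v \<phi>)"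

datatype nform = Hash | NImp fm nform | NAtBox nominal nform

primrec plug :: "nform \<Rightarrow> fm \<Rightarrow> fm" where
  "plug Hash \<psi> = \<psi>"
| "plug (NImp \<phi> L) \<psi> = \<phi> \<^bold>\<rightarrow> plug L \<psi>"
| "plug (NAtBox n L) \<psi> = At n (Box (plug L \<psi>))"

inductive HEFL :: "fm \<Rightarrow> bool" where
  Taut: "tautology \<phi> \<Longrightarrow> HEFL \<phi>"
| K_Box: "HEFL (Box (Var p \<^bold>\<rightarrow> Var q) \<^bold>\<rightarrow> (Box (Var p) \<^bold>\<rightarrow> Box (Var q)))"
| K_F: "HEFL (F (Var p \<^bold>\<rightarrow> Var q) \<^bold>\<rightarrow> (F (Var p) \<^bold>\<rightarrow> F (Var q)))"
| K_At: "HEFL (At n (Var p \<^bold>\<rightarrow> Var q) \<^bold>\<rightarrow> (At n (Var p) \<^bold>\<rightarrow> At n (Var q)))"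
| Ref: "HEFL (At n (Nom n))"
| Selfdual: "HEFL (Iff (Neg (At n (Var p))) (At n (Neg (Var p))))"
| Elim: "HEFL (At n (Var p) \<^bold>\<rightarrow> (Nom n \<^bold>\<rightarrow> Var p))"
| Agree: "HEFL (At n (At m (Var p)) \<^bold>\<rightarrow> At m (Var p))"
| Back: "HEFL (At n (Var p) \<^bold>\<rightarrow> F (At n (Var p)))"
| DCom: "HEFL (Iff (At n (Box (At n (Var p)))) (At n (Box (Var p))))"
| Rigid_eq: "HEFL (At n (Nom m) \<^bold>\<rightarrow> Box (At n (Nom m)))"
| Rigid_neq: "HEFL (Neg (At n (Nom m)) \<^bold>\<rightarrow> Box (Neg (At n (Nom m))))"
| MP: "HEFL (\<phi> \<^bold>\<rightarrow> \<psi>) \<Longrightarrow> HEFL \<phi> \<Longrightarrow> HEFL \<psi>"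
| Nec_Box: "HEFL \<phi> \<Longrightarrow> HEFL (Box \<phi>)"
| Nec_F: "HEFL \<phi> \<Longrightarrow> HEFL (F \<phi>)"
| Nec_At: "HEFL \<phi> \<Longrightarrow> HEFL (At n \<phi>)"
| USubst: "HEFL \<phi> \<Longrightarrow> HEFL (usubst \<sigma> \<rho> \<phi>)"
| Name: "HEFL (Nom n \<^bold>\<rightarrow> \<phi>) \<Longrightarrow> n \<notin> noms \<phi> \<Longrightarrow> HEFL \<phi>"
| LBG: "HEFL (plug L (At n (DiaF (Nom m)) \<^bold>\<rightarrow> At m \<phi>)) \<Longrightarrow> m \<notin> noms (plug L (At n (F \<phi>)))
    \<Longrightarrow> HEFL (plug L (At n (F \<phi>)))"


section \<open>Tree sequent calculus\<close>

text \<open>\<open>Child \<alpha> n i\<close> is the label $\alpha\cdot_n i$.\<close>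

datatype label = Root nat | Child label nominal nat

type_synonym lfm = "label \<times> fm"

definition is_tree :: "label set \<Rightarrow> bool" where
  "is_tree T \<longleftrightarrow> (\<exists>!i. Root i \<in> T) \<and> (\<forall>\<alpha> n i. Child \<alpha> n i \<in> T \<longrightarrow> \<alpha> \<in> T)"

definition tree_sequent :: "lfm set \<Rightarrow> label set \<Rightarrow> lfm set \<Rightarrow> bool" where
  "tree_sequent \<Gamma> T \<Delta> \<longleftrightarrow> finite \<Gamma> \<and> finite \<Delta> \<and> finite T \<and> is_tree T \<and>
     (\<forall>(\<alpha>, \<psi>) \<in> \<Gamma> \<union> \<Delta>. \<alpha> \<in> T \<and> at_prefixed \<psi>)"

primrec label_noms :: "label \<Rightarrow> nominal set" where
  "label_noms (Root i) = {}"
| "label_noms (Child \<alpha> n i) = insert n (label_noms \<alpha>)"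

primrec label_nats :: "label \<Rightarrow> nat set" where
  "label_nats (Root i) = {i}"
| "label_nats (Child \<alpha> n i) = insert i (label_nats \<alpha>)"

text \<open>The labels of \<open>\<Gamma>\<close> and \<open>\<Delta>\<close> belong to \<open>T\<close> in a tree sequent, so it suffices to
  collect what occurs in the labels from \<open>T\<close>.\<close>

definition seq_noms :: "lfm set \<Rightarrow> label set \<Rightarrow> lfm set \<Rightarrow> nominal set" where
  "seq_noms \<Gamma> T \<Delta> = (\<Union>\<alpha> \<in> T. label_noms \<alpha>) \<union> (\<Union>(\<alpha>, \<psi>) \<in> \<Gamma> \<union> \<Delta>. noms \<psi>)"

definition tree_nats :: "label set \<Rightarrow> nat set" where
  "tree_nats T = (\<Union>\<alpha> \<in> T. label_nats \<alpha>)"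

text \<open>Side conditions on labels are imposed only where they do not follow from the premises
  being tree sequents; \<open>TEFL_tree_sequent\<close> shows that derivations consist of tree sequents.\<close>

inductive TEFL :: "lfm set \<Rightarrow> label set \<Rightarrow> lfm set \<Rightarrow> bool" where
  Init_Bot: "tree_sequent (insert (\<alpha>, At n Bot) \<Gamma>) T \<Delta>
    \<Longrightarrow> TEFL (insert (\<alpha>, At n Bot) \<Gamma>) T \<Delta>"
| Init: "tree_sequent (insert (\<alpha>, At n \<phi>) \<Gamma>) T (insert (\<alpha>, At n \<phi>) \<Delta>)
    \<Longrightarrow> TEFL (insert (\<alpha>, At n \<phi>) \<Gamma>) T (insert (\<alpha>, At n \<phi>) \<Delta>)"
| Rep1: "TEFL (insert (\<alpha>, At n (Nom m)) (insert (\<alpha>, \<phi>[n/k]) \<Gamma>)) T \<Delta>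
    \<Longrightarrow> TEFL (insert (\<alpha>, At n (Nom m)) (insert (\<alpha>, \<phi>[m/k]) \<Gamma>)) T \<Delta>"
| Rep2: "TEFL (insert (\<alpha>, At n (Nom m)) (insert (\<alpha>, \<phi>[m/k]) \<Gamma>)) T \<Delta>
    \<Longrightarrow> TEFL (insert (\<alpha>, At n (Nom m)) (insert (\<alpha>, \<phi>[n/k]) \<Gamma>)) T \<Delta>"
| RefEq: "TEFL (insert (\<alpha>, At n (Nom n)) \<Gamma>) T \<Delta>
    \<Longrightarrow> TEFL \<Gamma> T \<Delta>"
| RigidEq: "TEFL (insert (\<beta>, At n (Nom m)) \<Gamma>) T \<Delta> \<Longrightarrow> \<alpha> \<in> T
    \<Longrightarrow> TEFL (insert (\<alpha>, At n (Nom m)) \<Gamma>) T \<Delta>"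
| ImpR: "TEFL (insert (\<alpha>, At n \<phi>) \<Gamma>) T (insert (\<alpha>, At n \<psi>) \<Delta>)
    \<Longrightarrow> TEFL \<Gamma> T (insert (\<alpha>, At n (\<phi> \<^bold>\<rightarrow> \<psi>)) \<Delta>)"
| ImpL: "TEFL \<Gamma> T (insert (\<alpha>, At n \<phi>) \<Delta>) \<Longrightarrow> TEFL (insert (\<alpha>, At n \<psi>) \<Gamma>) T \<Delta>
    \<Longrightarrow> TEFL (insert (\<alpha>, At n (\<phi> \<^bold>\<rightarrow> \<psi>)) \<Gamma>) T \<Delta>"
| AtR: "TEFL \<Gamma> T (insert (\<alpha>, At m \<phi>) \<Delta>)
    \<Longrightarrow> TEFL \<Gamma> T (insert (\<alpha>, At n (At m \<phi>)) \<Delta>)"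
| AtL: "TEFL (insert (\<alpha>, At m \<phi>) \<Gamma>) T \<Delta>
    \<Longrightarrow> TEFL (insert (\<alpha>, At n (At m \<phi>)) \<Gamma>) T \<Delta>"
| FR: "TEFL (insert (\<alpha>, At n (DiaF (Nom m))) \<Gamma>) T (insert (\<alpha>, At m \<phi>) \<Delta>)
    \<Longrightarrow> m \<notin> seq_noms \<Gamma> T (insert (\<alpha>, At n (F \<phi>)) \<Delta>)
    \<Longrightarrow> TEFL \<Gamma> T (insert (\<alpha>, At n (F \<phi>)) \<Delta>)"
| FL: "TEFL \<Gamma> T (insert (\<alpha>, At n (DiaF (Nom m))) \<Delta>) \<Longrightarrow> TEFL (insert (\<alpha>, At m \<phi>) \<Gamma>) T \<Delta>
    \<Longrightarrow> TEFL (insert (\<alpha>, At n (F \<phi>)) \<Gamma>) T \<Delta>"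
| BoxR: "TEFL \<Gamma> (T \<union> {Child \<alpha> n i}) (insert (Child \<alpha> n i, At n \<phi>) \<Delta>)
    \<Longrightarrow> tree_sequent \<Gamma> T (insert (\<alpha>, At n (Box \<phi>)) \<Delta>) \<Longrightarrow> i \<notin> tree_nats T
    \<Longrightarrow> TEFL \<Gamma> T (insert (\<alpha>, At n (Box \<phi>)) \<Delta>)"
| BoxL: "TEFL (insert (\<beta>, At n \<phi>) \<Gamma>) T \<Delta> \<Longrightarrow> \<beta> = Child \<alpha> n i
    \<Longrightarrow> TEFL (insert (\<alpha>, At n (Box \<phi>)) \<Gamma>) T \<Delta>"
| WLab: "TEFL \<Gamma> T \<Delta> \<Longrightarrow> is_tree (T \<union> {\<alpha>})
    \<Longrightarrow> TEFL \<Gamma> (T \<union> {\<alpha>}) \<Delta>"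
| Cut: "TEFL \<Gamma> T (insert (\<alpha>, At n \<phi>) \<Delta>) \<Longrightarrow> TEFL (insert (\<alpha>, At n \<phi>) \<Pi>) T \<Sigma>
    \<Longrightarrow> TEFL (\<Gamma> \<union> \<Pi>) T (\<Delta> \<union> \<Sigma>)"

lemma at_prefixed_At [simp]: "at_prefixed (At n \<phi>)"
  by (simp add: at_prefixed_def)

lemma at_prefixed_subst_nom [simp]: "at_prefixed (\<phi>[m/k]) \<longleftrightarrow> at_prefixed \<phi>"
  by (cases \<phi>) (auto simp: at_prefixed_def subst_nom_def)

lemma TEFL_tree_sequent: "TEFL \<Gamma> T \<Delta> \<Longrightarrow> tree_sequent \<Gamma> T \<Delta>"
proof (induction rule: TEFL.induct)
  case (BoxL \<beta> n \<phi> \<Gamma> T \<Delta> \<alpha> i)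
  then show ?case by (fastforce simp: tree_sequent_def is_tree_def)
qed (auto simp: tree_sequent_def)

end

theory Submission
  imports Defs
begin

text \<open>By induction on the Hilbert derivation we show more: for all uniform substitutions
  $(\sigma, \rho)$, trees, labels \<open>\<alpha>\<close> and nominals \<open>k\<close> (fresh or not), the sequent
  $\Rightarrow \alpha : @_k\varphi[\sigma,\rho]$ is derivable. Quantifying over the substitution
  makes the rule of uniform substitution trivial and makes it possible to rename the eigennominal
  of the rules \<open>Name\<close> and \<open>LBG\<close>: in \<open>Name\<close> it is sent to \<open>k\<close> itself, so that the premise becomes
  $@_k(k \to \varphi)$; in \<open>LBG\<close> it is sent to a nominal that is fresh for the whole sequent, and
  the necessity form is taken apart with the invertible rules, down to an instance of (F R).
  Tautologies are handled by Kalmar's argument: every atom is decided by cuts.\<close>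

section \<open>Freshness and substitution\<close>

lemma finite_noms: "finite (noms \<phi>)"
  by (induction \<phi>) auto

lemma finite_label_noms: "finite (label_noms \<alpha>)"
  by (induction \<alpha>) auto

lemma finite_label_nats: "finite (label_nats \<alpha>)"
  by (induction \<alpha>) auto

lemma finite_seq_noms: "tree_sequent \<Gamma> T \<Delta> \<Longrightarrow> finite (seq_noms \<Gamma> T \<Delta>)"
  by (auto simp: tree_sequent_def seq_noms_def finite_noms finite_label_noms)

lemma finite_tree_nats: "tree_sequent \<Gamma> T \<Delta> \<Longrightarrow> finite (tree_nats T)"
  by (auto simp: tree_sequent_def tree_nats_def finite_label_nats)

lemma ex_fresh_nominal: "finite S \<Longrightarrow> \<exists>m::nominal. m \<notin> S"
proof -
  assume "finite S"
  moreover have "infinite (range Nominal)"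
    by (simp add: finite_image_iff inj_def)
  ultimately show ?thesis
    by (metis finite_subset subsetI)
qed

lemma usubst_cong:
  "(\<And>n. n \<in> noms \<phi> \<Longrightarrow> \<rho> n = \<rho>' n) \<Longrightarrow> usubst \<sigma> \<rho> \<phi> = usubst \<sigma> \<rho>' \<phi>"
  by (induction \<phi>) auto

lemma usubst_Var_id: "usubst Var id \<phi> = \<phi>"
  by (induction \<phi>) auto

lemma usubst_fresh: "k \<notin> noms \<phi> \<Longrightarrow> usubst \<sigma> (\<rho>(k := m)) \<phi> = usubst \<sigma> \<rho> \<phi>"
  by (rule usubst_cong) auto

text \<open>Composites of uniform substitutions are again uniform substitutions, so the rule
  \<open>USubst\<close> becomes an instance of an induction hypothesis that quantifies over all of
  them.\<close>

lemma usubst_usubst: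
  "usubst \<sigma> \<rho> (usubst \<sigma>' \<rho>' \<phi>) = usubst (\<lambda>p. usubst \<sigma> \<rho> (\<sigma>' p)) (\<rho> \<circ> \<rho>') \<phi>"
  by (induction \<phi>) auto

text \<open>\<open>tval\<close> consults its valuation only at formulas that it treats as atoms;
  there the new valuation answers with the value of the substitution instance.\<close>

lemma tval_usubst: "tval v (usubst \<sigma> \<rho> \<phi>) = tval (\<lambda>a. tval v (usubst \<sigma> \<rho> a)) \<phi>"
  by (induction \<phi>) auto

lemma tautology_usubst: "tautology \<phi> \<Longrightarrow> tautology (usubst \<sigma> \<rho> \<phi>)"
  unfolding tautology_def by (subst tval_usubst) blast

primrec usubst_nform :: "(propvar \<Rightarrow> fm) \<Rightarrow> (nominal \<Rightarrow> nominal) \<Rightarrow> nform \<Rightarrow> nform" where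
  "usubst_nform \<sigma> \<rho> Hash = Hash"
| "usubst_nform \<sigma> \<rho> (NImp \<phi> L) = NImp (usubst \<sigma> \<rho> \<phi>) (usubst_nform \<sigma> \<rho> L)"
| "usubst_nform \<sigma> \<rho> (NAtBox n L) = NAtBox (\<rho> n) (usubst_nform \<sigma> \<rho> L)"

lemma usubst_plug: "usubst \<sigma> \<rho> (plug L \<phi>) = plug (usubst_nform \<sigma> \<rho> L) (usubst \<sigma> \<rho> \<phi>)"
  by (induction L) auto

text \<open>Used to rename the eigennominal of \<open>LBG\<close> without disturbing the surrounding
  necessity form.\<close>

lemma usubst_nform_fresh:
  "k \<notin> noms (plug L \<phi>) \<Longrightarrow> usubst_nform \<sigma> (\<rho>(k := m)) L = usubst_nform \<sigma> \<rho> L"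
  by (induction L) (auto simp: usubst_fresh)

lemma noms_plug_hole: "noms \<phi> \<subseteq> noms (plug L \<phi>)"
  by (induction L) auto

section \<open>The rules in cumulative form\<close>

text \<open>Well-formedness passes from the conclusion of a cumulative rule to its premises, so making it
  a hypothesis here leaves the rules below free of such side conditions.\<close>

definition derivable :: "lfm set \<Rightarrow> label set \<Rightarrow> lfm set \<Rightarrow> bool" where
  "derivable \<Gamma> T \<Delta> \<longleftrightarrow> (tree_sequent \<Gamma> T \<Delta> \<longrightarrow> TEFL \<Gamma> T \<Delta>)"

lemma derivable_init:
  assumes "(\<alpha>, At n \<phi>) \<in> \<Gamma>" "(\<alpha>, At n \<phi>) \<in> \<Delta>"
  shows "derivable \<Gamma> T \<Delta>"
  using Init[of \<alpha> n \<phi> \<Gamma> T \<Delta>] assms by (simp add: derivable_def insert_absorb)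

lemma derivable_BotL:
  assumes "(\<alpha>, At n Bot) \<in> \<Gamma>"
  shows "derivable \<Gamma> T \<Delta>"
  using Init_Bot[of \<alpha> n \<Gamma> T \<Delta>] assms by (simp add: derivable_def insert_absorb)

lemma derivable_refEq:
  assumes "derivable (insert (\<alpha>, At n (Nom n)) \<Gamma>) T \<Delta>" "\<alpha> \<in> T"
  shows "derivable \<Gamma> T \<Delta>"
  using RefEq[of \<alpha> n \<Gamma> T \<Delta>] assms by (auto simp: derivable_def tree_sequent_def)

lemma derivable_rigidEq:
  assumes "(\<alpha>, At n (Nom m)) \<in> \<Gamma>" "derivable (insert (\<beta>, At n (Nom m)) \<Gamma>) T \<Delta>" "\<beta> \<in> T"
  shows "derivable \<Gamma> T \<Delta>"
  using RigidEq[of \<beta> n m \<Gamma> T \<Delta> \<alpha>] assms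
  by (auto simp: derivable_def tree_sequent_def insert_absorb)

text \<open>\<open>Rep1\<close> speaks of instances of one schema. With \<open>k\<close> fresh for
  \<open>\<phi>\<close>, the schema \<open>At k \<phi>\<close> has its only occurrence of
  \<open>k\<close> in the prefix, so replacement changes the prefix and nothing else.\<close>

lemma derivable_rep:
  assumes "(\<alpha>, At n (Nom m)) \<in> \<Gamma>" "(\<alpha>, At m \<phi>) \<in> \<Gamma>"
    and "derivable (insert (\<alpha>, At n \<phi>) \<Gamma>) T \<Delta>"
  shows "derivable \<Gamma> T \<Delta>"
proof -
  obtain k where k: "k \<notin> noms \<phi>"
    using ex_fresh_nominal[OF finite_noms] by blast
  have subst: "subst_nom (At k \<phi>) j k = At j \<phi>" for j
    using k by (simp add: subst_nom_def usubst_fresh usubst_Var_id)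
  have "insert (\<alpha>, At n (Nom m)) (insert (\<alpha>, At n \<phi>) \<Gamma>) = insert (\<alpha>, At n \<phi>) \<Gamma>"
    using assms by auto
  then show ?thesis
    using Rep1[of \<alpha> n m "At k \<phi>" k \<Gamma> T \<Delta>] assms
    by (auto simp: subst derivable_def tree_sequent_def insert_absorb)
qed

lemma derivable_ImpR:
  assumes "(\<alpha>, At n (\<phi> \<^bold>\<rightarrow> \<psi>)) \<in> \<Delta>"
    and "derivable (insert (\<alpha>, At n \<phi>) \<Gamma>) T (insert (\<alpha>, At n \<psi>) \<Delta>)"
  shows "derivable \<Gamma> T \<Delta>"
  using ImpR[of \<alpha> n \<phi> \<Gamma> T \<psi> \<Delta>] assms
  by (auto simp: derivable_def tree_sequent_def insert_absorb)

lemma derivable_ImpL: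
  assumes "(\<alpha>, At n (\<phi> \<^bold>\<rightarrow> \<psi>)) \<in> \<Gamma>"
    and "derivable \<Gamma> T (insert (\<alpha>, At n \<phi>) \<Delta>)" "derivable (insert (\<alpha>, At n \<psi>) \<Gamma>) T \<Delta>"
  shows "derivable \<Gamma> T \<Delta>"
  using ImpL[of \<Gamma> T \<alpha> n \<phi> \<Delta> \<psi>] assms
  by (auto simp: derivable_def tree_sequent_def insert_absorb)

lemma derivable_AtR:
  assumes "(\<alpha>, At n (At m \<phi>)) \<in> \<Delta>" "derivable \<Gamma> T (insert (\<alpha>, At m \<phi>) \<Delta>)"
  shows "derivable \<Gamma> T \<Delta>"
  using AtR[of \<Gamma> T \<alpha> m \<phi> \<Delta> n] assms
  by (auto simp: derivable_def tree_sequent_def insert_absorb)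

lemma derivable_AtL:
  assumes "(\<alpha>, At n (At m \<phi>)) \<in> \<Gamma>" "derivable (insert (\<alpha>, At m \<phi>) \<Gamma>) T \<Delta>"
  shows "derivable \<Gamma> T \<Delta>"
  using AtL[of \<alpha> m \<phi> \<Gamma> T \<Delta> n] assms
  by (auto simp: derivable_def tree_sequent_def insert_absorb)

lemma derivable_FR_fresh:
  assumes "m \<notin> seq_noms \<Gamma> T (insert (\<alpha>, At n (F \<phi>)) \<Delta>)"
    and "derivable (insert (\<alpha>, At n (DiaF (Nom m))) \<Gamma>) T (insert (\<alpha>, At m \<phi>) \<Delta>)"
  shows "derivable \<Gamma> T (insert (\<alpha>, At n (F \<phi>)) \<Delta>)"
  using FR[of \<alpha> n m \<Gamma> T \<phi> \<Delta>] assms by (auto simp: derivable_def tree_sequent_def)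

text \<open>Asking for the premise at every \<open>m\<close> hides the eigennominal condition: a
  tree sequent is finite and so leaves some nominal fresh, while for anything else
  \<open>derivable\<close> holds vacuously.\<close>

lemma derivable_FR:
  assumes "(\<alpha>, At n (F \<phi>)) \<in> \<Delta>"
    and "\<And>m. derivable (insert (\<alpha>, At n (DiaF (Nom m))) \<Gamma>) T (insert (\<alpha>, At m \<phi>) \<Delta>)"
  shows "derivable \<Gamma> T \<Delta>"
proof (cases "tree_sequent \<Gamma> T \<Delta>")
  case True
  then obtain m where "m \<notin> seq_noms \<Gamma> T \<Delta>"
    using ex_fresh_nominal[OF finite_seq_noms] by metis
  then show ?thesis
    using derivable_FR_fresh[of m \<Gamma> T \<alpha> n \<phi> \<Delta>] assms by (simp add: insert_absorb)
qed (simp add: derivable_def)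

lemma derivable_FL:
  assumes "(\<alpha>, At n (F \<phi>)) \<in> \<Gamma>"
    and "derivable \<Gamma> T (insert (\<alpha>, At n (DiaF (Nom m))) \<Delta>)"
    and "derivable (insert (\<alpha>, At m \<phi>) \<Gamma>) T \<Delta>"
  shows "derivable \<Gamma> T \<Delta>"
  using FL[of \<Gamma> T \<alpha> n m \<Delta> \<phi>] assms
  by (auto simp: derivable_def tree_sequent_def insert_absorb)

lemma is_tree_insert_Child: "is_tree T \<Longrightarrow> \<alpha> \<in> T \<Longrightarrow> is_tree (insert (Child \<alpha> n i) T)"
  by (simp add: is_tree_def)

text \<open>Finiteness of the tree provides the fresh index. The premise need not repeat the
  principal formula, which suits the induction hypotheses for \<open>Nec_Box\<close> and for
  necessity forms.\<close>

lemma derivable_BoxR_elim: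
  assumes "\<And>i. derivable \<Gamma> (insert (Child \<alpha> n i) T) (insert (Child \<alpha> n i, At n \<phi>) \<Delta>)"
  shows "derivable \<Gamma> T (insert (\<alpha>, At n (Box \<phi>)) \<Delta>)"
  unfolding derivable_def
proof
  assume ts: "tree_sequent \<Gamma> T (insert (\<alpha>, At n (Box \<phi>)) \<Delta>)"
  then obtain i where i: "i \<notin> tree_nats T"
    using ex_new_if_finite[OF infinite_UNIV_nat finite_tree_nats] by metis
  have "tree_sequent \<Gamma> (insert (Child \<alpha> n i) T) (insert (Child \<alpha> n i, At n \<phi>) \<Delta>)"
    using ts by (auto simp: tree_sequent_def is_tree_insert_Child)
  then have "TEFL \<Gamma> (T \<union> {Child \<alpha> n i}) (insert (Child \<alpha> n i, At n \<phi>) \<Delta>)"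
    using assms by (simp add: derivable_def)
  then show "TEFL \<Gamma> T (insert (\<alpha>, At n (Box \<phi>)) \<Delta>)"
    by (rule BoxR[OF _ ts i])
qed

lemma derivable_BoxR:
  assumes "(\<alpha>, At n (Box \<phi>)) \<in> \<Delta>"
    and "\<And>i. derivable \<Gamma> (insert (Child \<alpha> n i) T) (insert (Child \<alpha> n i, At n \<phi>) \<Delta>)"
  shows "derivable \<Gamma> T \<Delta>"
  using derivable_BoxR_elim[of \<Gamma> \<alpha> n T \<phi> \<Delta>] assms by (simp add: insert_absorb)

lemma derivable_BoxL:
  assumes "(\<alpha>, At n (Box \<phi>)) \<in> \<Gamma>" "derivable (insert (Child \<alpha> n i, At n \<phi>) \<Gamma>) T \<Delta>"
    and "Child \<alpha> n i \<in> T"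
  shows "derivable \<Gamma> T \<Delta>"
  using BoxL[of "Child \<alpha> n i" n \<phi> \<Gamma> T \<Delta> \<alpha> i] assms
  by (auto simp: derivable_def tree_sequent_def insert_absorb)

lemma derivable_cut:
  assumes "derivable \<Gamma> T (insert (\<alpha>, At n \<phi>) \<Delta>)" "derivable (insert (\<alpha>, At n \<phi>) \<Gamma>) T \<Delta>" "\<alpha> \<in> T"
  shows "derivable \<Gamma> T \<Delta>"
  using Cut[of \<Gamma> T \<alpha> n \<phi> \<Delta> \<Gamma> \<Delta>] assms by (auto simp: derivable_def tree_sequent_def)

text \<open>The calculus has no weakening rule; a cut against an initial sequent replaces it, at the
  price of requiring a formula on the right.\<close>

lemma derivable_weaken:
  assumes "derivable \<Gamma> T \<Delta>" "(\<alpha>, At n \<phi>) \<in> \<Delta>" "\<Gamma> \<subseteq> \<Gamma>'" "\<Delta> \<subseteq> \<Delta>'"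
  shows "derivable \<Gamma>' T \<Delta>'"
  unfolding derivable_def
proof
  assume ts: "tree_sequent \<Gamma>' T \<Delta>'"
  then have "tree_sequent \<Gamma> T \<Delta>"
    using assms(3,4) by (auto simp: tree_sequent_def intro: finite_subset)
  then have "TEFL \<Gamma> T (insert (\<alpha>, At n \<phi>) \<Delta>)"
    using assms(1,2) by (simp add: derivable_def insert_absorb)
  moreover have "TEFL (insert (\<alpha>, At n \<phi>) \<Gamma>') T \<Delta>'"
  proof -
    have "(\<alpha>, At n \<phi>) \<in> \<Delta>'"
      using assms(2,4) by auto
    moreover from this have "tree_sequent (insert (\<alpha>, At n \<phi>) \<Gamma>') T \<Delta>'"
      using ts by (auto simp: tree_sequent_def)
    ultimately show ?thesis
      using Init[of \<alpha> n \<phi> \<Gamma>' T \<Delta>'] by (simp add: insert_absorb)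
  qed
  ultimately have "TEFL (\<Gamma> \<union> \<Gamma>') T (\<Delta> \<union> \<Delta>')"
    by (rule Cut)
  then show "TEFL \<Gamma>' T \<Delta>'"
    using assms(3,4) by (simp add: Un_absorb1)
qed

section \<open>Inversion\<close>

text \<open>With cut available, inversion needs no induction on derivations: the compound formula is
  cut against the sequent in which the left rule splits it into its parts. The other inversions
  follow the same pattern.\<close>

lemma derivable_ImpR_inv:
  assumes "derivable \<Gamma> T (insert (\<alpha>, At n (\<phi> \<^bold>\<rightarrow> \<psi>)) \<Delta>)" "\<alpha> \<in> T"
  shows "derivable (insert (\<alpha>, At n \<phi>) \<Gamma>) T (insert (\<alpha>, At n \<psi>) \<Delta>)"
proof (rule derivable_cut[OF _ _ assms(2)])
  show "derivable (insert (\<alpha>, At n \<phi>) \<Gamma>) T (insert (\<alpha>, At n (\<phi> \<^bold>\<rightarrow> \<psi>)) (insert (\<alpha>, At n \<psi>) \<Delta>))"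
    by (rule derivable_weaken[OF assms(1) insertI1]) auto
  show "derivable (insert (\<alpha>, At n (\<phi> \<^bold>\<rightarrow> \<psi>)) (insert (\<alpha>, At n \<phi>) \<Gamma>)) T (insert (\<alpha>, At n \<psi>) \<Delta>)"
    by (rule derivable_ImpL[OF insertI1 derivable_init[OF _ insertI1] derivable_init[OF insertI1]]) auto
qed

lemma derivable_AtR_inv:
  assumes "derivable \<Gamma> T (insert (\<alpha>, At n (At m \<phi>)) \<Delta>)" "\<alpha> \<in> T"
  shows "derivable \<Gamma> T (insert (\<alpha>, At m \<phi>) \<Delta>)"
proof (rule derivable_cut[OF _ _ assms(2)])
  show "derivable \<Gamma> T (insert (\<alpha>, At n (At m \<phi>)) (insert (\<alpha>, At m \<phi>) \<Delta>))"
    by (rule derivable_weaken[OF assms(1) insertI1]) auto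
  show "derivable (insert (\<alpha>, At n (At m \<phi>)) \<Gamma>) T (insert (\<alpha>, At m \<phi>) \<Delta>)"
    by (rule derivable_AtL[OF insertI1 derivable_init[OF insertI1]]) simp
qed

text \<open>The formula displayed on the right is what \<open>derivable_weaken\<close>
  needs.\<close>

lemma derivable_AtL_inv:
  assumes "derivable (insert (\<alpha>, At n (At m \<phi>)) \<Gamma>) T (insert (\<beta>, At k \<psi>) \<Delta>)" "\<alpha> \<in> T"
  shows "derivable (insert (\<alpha>, At m \<phi>) \<Gamma>) T (insert (\<beta>, At k \<psi>) \<Delta>)"
proof (rule derivable_cut[OF _ _ assms(2)])
  show "derivable (insert (\<alpha>, At m \<phi>) \<Gamma>) T (insert (\<alpha>, At n (At m \<phi>)) (insert (\<beta>, At k \<psi>) \<Delta>))"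
    by (rule derivable_AtR[OF insertI1 derivable_init[OF _ insertI1]]) simp
  show "derivable (insert (\<alpha>, At n (At m \<phi>)) (insert (\<alpha>, At m \<phi>) \<Gamma>)) T (insert (\<beta>, At k \<psi>) \<Delta>)"
    by (rule derivable_weaken[OF assms(1) insertI1]) auto
qed

text \<open>\<open>WLab\<close> first adds the child, then \<open>BoxL\<close> instantiates the box
  there, for any index. Well-formedness over \<open>T\<close> is assumed because it does not follow
  from well-formedness over the larger tree.\<close>

lemma derivable_BoxR_inv:
  assumes "derivable \<Gamma> T (insert (\<alpha>, At n (Box \<phi>)) \<Delta>)"
    and ts: "tree_sequent \<Gamma> T (insert (\<alpha>, At n (Box \<phi>)) \<Delta>)"
  shows "derivable \<Gamma> (insert (Child \<alpha> n i) T) (insert (Child \<alpha> n i, At n \<phi>) \<Delta>)"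
proof (rule derivable_cut)
  let ?T = "insert (Child \<alpha> n i) T"
  have \<alpha>: "\<alpha> \<in> T" and "is_tree T"
    using ts by (auto simp: tree_sequent_def)
  then have "TEFL \<Gamma> (T \<union> {Child \<alpha> n i}) (insert (\<alpha>, At n (Box \<phi>)) \<Delta>)"
    using assms by (intro WLab) (auto simp: derivable_def is_tree_insert_Child)
  then have "derivable \<Gamma> ?T (insert (\<alpha>, At n (Box \<phi>)) \<Delta>)"
    by (simp add: derivable_def)
  then show "derivable \<Gamma> ?T (insert (\<alpha>, At n (Box \<phi>)) (insert (Child \<alpha> n i, At n \<phi>) \<Delta>))"
    by (rule derivable_weaken[OF _ insertI1]) auto
  show "derivable (insert (\<alpha>, At n (Box \<phi>)) \<Gamma>) ?T (insert (Child \<alpha> n i, At n \<phi>) \<Delta>)"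
    by (rule derivable_BoxL[OF insertI1 derivable_init[OF insertI1], where i = i]) auto
  show "\<alpha> \<in> ?T"
    using \<alpha> by simp
qed

section \<open>Tautologies\<close>

text \<open>These are the subformulas at which \<open>tval v \<phi>\<close> consults
  \<open>v\<close>.\<close>

primrec prop_atoms :: "fm \<Rightarrow> fm set" where
  "prop_atoms (Nom n) = {Nom n}"
| "prop_atoms (Var p) = {Var p}"
| "prop_atoms Bot = {}"
| "prop_atoms (\<phi> \<^bold>\<rightarrow> \<psi>) = prop_atoms \<phi> \<union> prop_atoms \<psi>"
| "prop_atoms (At n \<phi>) = {At n \<phi>}"
| "prop_atoms (F \<phi>) = {F \<phi>}"
| "prop_atoms (Box \<phi>) = {Box \<phi>}"

lemma finite_prop_atoms: "finite (prop_atoms \<phi>)"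
  by (induction \<phi>) auto

text \<open>Kalmar's lemma in two-sided form. True atoms stand on the left and false ones on the
  right, while \<open>\<phi>\<close> stands on the side contradicting its value; decomposing it ends
  in \<open>Bot\<close> on the left or in an atom on both sides.\<close>

lemma derivable_by_valuation:
  assumes "\<And>a. a \<in> prop_atoms \<phi> \<Longrightarrow> if v a then (\<alpha>, At k a) \<in> \<Gamma> else (\<alpha>, At k a) \<in> \<Delta>"
    and "if tval v \<phi> then (\<alpha>, At k \<phi>) \<in> \<Delta> else (\<alpha>, At k \<phi>) \<in> \<Gamma>"
  shows "derivable \<Gamma> T \<Delta>"
  using assms
proof (induction \<phi> arbitrary: \<Gamma> \<Delta>)
  case (Imp \<phi> \<psi>)
  have atoms: "if v a then (\<alpha>, At k a) \<in> \<Gamma> else (\<alpha>, At k a) \<in> \<Delta>"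
    if "a \<in> prop_atoms \<phi> \<union> prop_atoms \<psi>" for a
    using Imp.prems(1)[of a] that by simp
  show ?case
  proof (cases "tval v (\<phi> \<^bold>\<rightarrow> \<psi>)")
    case True
    then have "(\<alpha>, At k (\<phi> \<^bold>\<rightarrow> \<psi>)) \<in> \<Delta>"
      using Imp.prems(2) by simp
    moreover have "derivable (insert (\<alpha>, At k \<phi>) \<Gamma>) T (insert (\<alpha>, At k \<psi>) \<Delta>)"
    \<comment> \<open>A true implication has a true consequent, now on the right, or a false
      antecedent, now on the left; either one closes the sequent by induction.\<close>
    proof (cases "tval v \<psi>")
      case True
      show ?thesis
      proof (rule Imp.IH(2))
        show "if v a then (\<alpha>, At k a) \<in> insert (\<alpha>, At k \<phi>) \<Gamma>
            else (\<alpha>, At k a) \<in> insert (\<alpha>, At k \<psi>) \<Delta>" if "a \<in> prop_atoms \<psi>" for a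
          using atoms[of a] that by (auto split: if_splits)
      qed (use True in simp)
    next
      case False
      show ?thesis
      proof (rule Imp.IH(1))
        show "if v a then (\<alpha>, At k a) \<in> insert (\<alpha>, At k \<phi>) \<Gamma>
            else (\<alpha>, At k a) \<in> insert (\<alpha>, At k \<psi>) \<Delta>" if "a \<in> prop_atoms \<phi>" for a
          using atoms[of a] that by (auto split: if_splits)
      qed (use True False in simp)
    qed
    ultimately show ?thesis
      by (rule derivable_ImpR)
  next
    case False
    then have "(\<alpha>, At k (\<phi> \<^bold>\<rightarrow> \<psi>)) \<in> \<Gamma>"
      using Imp.prems(2) by (simp split: if_splits)
    moreover have "derivable \<Gamma> T (insert (\<alpha>, At k \<phi>) \<Delta>)"
    proof (rule Imp.IH(1))
      show "if v a then (\<alpha>, At k a) \<in> \<Gamma> else (\<alpha>, At k a) \<in> insert (\<alpha>, At k \<phi>) \<Delta>"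
        if "a \<in> prop_atoms \<phi>" for a
        using atoms[of a] that by (auto split: if_splits)
    qed (use False in simp)
    moreover have "derivable (insert (\<alpha>, At k \<psi>) \<Gamma>) T \<Delta>"
    proof (rule Imp.IH(2))
      show "if v a then (\<alpha>, At k a) \<in> insert (\<alpha>, At k \<psi>) \<Gamma> else (\<alpha>, At k a) \<in> \<Delta>"
        if "a \<in> prop_atoms \<psi>" for a
        using atoms[of a] that by (auto split: if_splits)
    qed (use False in simp)
    ultimately show ?thesis
      by (rule derivable_ImpL)
  qed
qed (auto intro: derivable_init derivable_BotL split: if_splits)

text \<open>Each induction step removes one atom by a cut on it; the two cut premises are the
  hypothesis at valuations that differ only at that atom.\<close>

lemma derivable_decide_atoms:
  assumes "finite A" "\<alpha> \<in> T"
    and "\<And>v. derivable ((\<lambda>a. (\<alpha>, At k a)) ` {a \<in> A. v a}) T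
           (insert (\<alpha>, At k \<phi>) ((\<lambda>a. (\<alpha>, At k a)) ` {a \<in> A. \<not> v a}))"
  shows "derivable {} T {(\<alpha>, At k \<phi>)}"
  using assms(1,3)
proof (induction A rule: finite_induct)
  case (insert b A)
  let ?lab = "\<lambda>a. (\<alpha>, At k a)"
  \<comment> \<open>Since \<open>b\<close> is not in \<open>A\<close>, updating \<open>v\<close> at
    \<open>b\<close> leaves the sorting of \<open>A\<close> unchanged.\<close>
  have pos: "{a \<in> insert b A. (v(b := True)) a} = insert b {a \<in> A. v a}"
    "{a \<in> insert b A. \<not> (v(b := True)) a} = {a \<in> A. \<not> v a}"
    and neg: "{a \<in> insert b A. (v(b := False)) a} = {a \<in> A. v a}"
    "{a \<in> insert b A. \<not> (v(b := False)) a} = insert b {a \<in> A. \<not> v a}" for v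
    using insert.hyps by auto
  show ?case
  proof (rule insert.IH)
    fix v
    have "derivable (insert (?lab b) (?lab ` {a \<in> A. v a})) T
        (insert (?lab \<phi>) (?lab ` {a \<in> A. \<not> v a}))"
      using insert.prems[of "v(b := True)"] unfolding pos image_insert .
    moreover have "derivable (?lab ` {a \<in> A. v a}) T
        (insert (?lab b) (insert (?lab \<phi>) (?lab ` {a \<in> A. \<not> v a})))"
      using insert.prems[of "v(b := False)"] unfolding neg image_insert
      by (simp add: insert_commute)
    ultimately show "derivable (?lab ` {a \<in> A. v a}) T
        (insert (?lab \<phi>) (?lab ` {a \<in> A. \<not> v a}))"
      using derivable_cut[OF _ _ assms(2)] by simp
  qed
qed simp

lemma derivable_tautology:
  assumes "tautology \<phi>" "\<alpha> \<in> T"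
  shows "derivable {} T {(\<alpha>, At k \<phi>)}"
proof (rule derivable_decide_atoms[OF finite_prop_atoms assms(2)])
  fix v
  show "derivable ((\<lambda>a. (\<alpha>, At k a)) ` {a \<in> prop_atoms \<phi>. v a}) T
      (insert (\<alpha>, At k \<phi>) ((\<lambda>a. (\<alpha>, At k a)) ` {a \<in> prop_atoms \<phi>. \<not> v a}))"
    using assms(1) by (intro derivable_by_valuation[of \<phi> v \<alpha> k]) (auto simp: tautology_def)
qed

section \<open>Necessity forms\<close>

text \<open>Each layer of \<open>L\<close> is removed by inversion and restored by the matching
  right rule. At the hole, inversion yields exactly the premise of \<open>FR\<close>. The sequent is
  generalised because layers add antecedents and child labels.\<close>

lemma derivable_plug_F:
  assumes "derivable \<Gamma> T (insert (\<alpha>, At k (plug L (At n (DiaF (Nom m)) \<^bold>\<rightarrow> At m \<phi>))) \<Delta>)"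
    and "m \<notin> seq_noms \<Gamma> T (insert (\<alpha>, At k (plug L (At n (F \<phi>)))) \<Delta>)"
    and "tree_sequent \<Gamma> T (insert (\<alpha>, At k (plug L (At n (F \<phi>)))) \<Delta>)"
  shows "derivable \<Gamma> T (insert (\<alpha>, At k (plug L (At n (F \<phi>)))) \<Delta>)"
  using assms
proof (induction L arbitrary: \<Gamma> T \<Delta> \<alpha> k)
  case Hash
  have \<alpha>: "\<alpha> \<in> T"
    using Hash.prems(3) by (auto simp: tree_sequent_def)
  have "derivable (insert (\<alpha>, At k (At n (DiaF (Nom m)))) \<Gamma>) T (insert (\<alpha>, At k (At m \<phi>)) \<Delta>)"
    by (rule derivable_ImpR_inv[OF Hash.prems(1)[unfolded plug.simps] \<alpha>])
  then have "derivable (insert (\<alpha>, At n (DiaF (Nom m))) \<Gamma>) T (insert (\<alpha>, At m \<phi>) \<Delta>)"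
    by (rule derivable_AtL_inv[OF derivable_AtR_inv[OF _ \<alpha>] \<alpha>])
  moreover have "m \<notin> seq_noms \<Gamma> T (insert (\<alpha>, At n (F \<phi>)) \<Delta>)"
    using Hash.prems(2) by (auto simp: seq_noms_def)
  ultimately have "derivable \<Gamma> T (insert (\<alpha>, At n (F \<phi>)) \<Delta>)"
    by (rule derivable_FR_fresh[rotated])
  \<comment> \<open>The cumulative \<open>derivable_AtR\<close> keeps its principal formula in the
    premise, so that formula is weakened in first.\<close>
  then have "derivable \<Gamma> T (insert (\<alpha>, At n (F \<phi>)) (insert (\<alpha>, At k (At n (F \<phi>))) \<Delta>))"
    by (rule derivable_weaken[OF _ insertI1]) auto
  then show ?case
    unfolding plug.simps by (rule derivable_AtR[OF insertI1])
next
  case (NImp \<psi> L)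
  have \<alpha>: "\<alpha> \<in> T"
    using NImp.prems(3) by (auto simp: tree_sequent_def)
  have "derivable (insert (\<alpha>, At k \<psi>) \<Gamma>) T (insert (\<alpha>, At k (plug L (At n (F \<phi>)))) \<Delta>)"
  proof (rule NImp.IH)
    show "derivable (insert (\<alpha>, At k \<psi>) \<Gamma>) T
        (insert (\<alpha>, At k (plug L (At n (DiaF (Nom m)) \<^bold>\<rightarrow> At m \<phi>))) \<Delta>)"
      by (rule derivable_ImpR_inv[OF NImp.prems(1)[unfolded plug.simps] \<alpha>])
  qed (use NImp.prems(2,3) in \<open>auto simp: seq_noms_def tree_sequent_def\<close>)
  then have "derivable (insert (\<alpha>, At k \<psi>) \<Gamma>) T (insert (\<alpha>, At k (plug L (At n (F \<phi>))))
      (insert (\<alpha>, At k (\<psi> \<^bold>\<rightarrow> plug L (At n (F \<phi>)))) \<Delta>))"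
    by (rule derivable_weaken[OF _ insertI1]) auto
  then show ?case
    unfolding plug.simps by (rule derivable_ImpR[OF insertI1])
next
  case (NAtBox j L)
  have \<alpha>: "\<alpha> \<in> T" and tree: "is_tree T"
    using NAtBox.prems(3) by (auto simp: tree_sequent_def)
  let ?X = "plug L (At n (DiaF (Nom m)) \<^bold>\<rightarrow> At m \<phi>)" and ?Y = "plug L (At n (F \<phi>))"
  have "derivable \<Gamma> T (insert (\<alpha>, At j (Box ?X)) \<Delta>)"
    by (rule derivable_AtR_inv[OF NAtBox.prems(1)[unfolded plug.simps] \<alpha>])
  moreover have "tree_sequent \<Gamma> T (insert (\<alpha>, At j (Box ?X)) \<Delta>)"
    using NAtBox.prems(3) by (auto simp: tree_sequent_def)
  ultimately have child: "derivable \<Gamma> (insert (Child \<alpha> j i) T) (insert (Child \<alpha> j i, At j ?X) \<Delta>)"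
    for i by (rule derivable_BoxR_inv)
  have "derivable \<Gamma> (insert (Child \<alpha> j i) T) (insert (Child \<alpha> j i, At j ?Y) \<Delta>)" for i
  proof (rule NAtBox.IH[OF child])
    \<comment> \<open>The new label contributes only \<open>j\<close> and the nominals of
      \<open>\<alpha>\<close>, all of which already occur in the sequent.\<close>
    show "m \<notin> seq_noms \<Gamma> (insert (Child \<alpha> j i) T) (insert (Child \<alpha> j i, At j ?Y) \<Delta>)"
      using NAtBox.prems(2) \<alpha> by (auto simp: seq_noms_def)
    show "tree_sequent \<Gamma> (insert (Child \<alpha> j i) T) (insert (Child \<alpha> j i, At j ?Y) \<Delta>)"
      using NAtBox.prems(3) \<alpha> tree by (auto simp: tree_sequent_def is_tree_insert_Child)
  qed
  then have "derivable \<Gamma> T (insert (\<alpha>, At j (Box ?Y)) \<Delta>)"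
    by (rule derivable_BoxR_elim)
  then have "derivable \<Gamma> T (insert (\<alpha>, At j (Box ?Y)) (insert (\<alpha>, At k (At j (Box ?Y))) \<Delta>))"
    by (rule derivable_weaken[OF _ insertI1]) auto
  then show ?case
    unfolding plug.simps by (rule derivable_AtR[OF insertI1])
qed

section \<open>From the Hilbert system to the tree sequent calculus\<close>

text \<open>Unfolded, \<open>Iff\<close> is a negated implication into a negation: one
  \<open>ImpR\<close> and two \<open>ImpL\<close> expose the two directions and leave
  \<open>Bot\<close> on the left.\<close>

lemma derivable_IffR:
  assumes "derivable {(\<alpha>, At k \<phi>)} T {(\<alpha>, At k \<psi>)}" "derivable {(\<alpha>, At k \<psi>)} T {(\<alpha>, At k \<phi>)}"
  shows "derivable {} T {(\<alpha>, At k (Iff \<phi> \<psi>))}"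
proof -
  have imp: "derivable \<Gamma> T (insert (\<alpha>, At k (\<chi> \<^bold>\<rightarrow> \<xi>)) \<Delta>)"
    if "derivable {(\<alpha>, At k \<chi>)} T {(\<alpha>, At k \<xi>)}" for \<Gamma> \<Delta> \<chi> \<xi>
    by (rule derivable_ImpR[OF insertI1], rule derivable_weaken[OF that insertI1]) auto
  show ?thesis
    by (rule derivable_ImpR[OF insertI1], rule derivable_ImpL[OF insertI1 imp[OF assms(1)]],
        rule derivable_ImpL[OF insertI1 imp[OF assms(2)]], rule derivable_BotL[OF insertI1])
qed

text \<open>Tree, label and prefix vary in the induction: \<open>Nec_Box\<close> moves to a new
  child, \<open>Nec_F\<close> and \<open>Nec_At\<close> to another prefix.\<close>

lemma HEFL_derivable:
  assumes "HEFL \<phi>" "finite T" "is_tree T" "\<alpha> \<in> T"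
  shows "derivable {} T {(\<alpha>, At k (usubst \<sigma> \<rho> \<phi>))}"
  using assms
proof (induction arbitrary: T \<alpha> k \<sigma> \<rho> rule: HEFL.induct)
  case (Taut \<phi>)
  then show ?case
    by (simp add: derivable_tautology tautology_usubst)
next
  case (K_Box p q)
  \<comment> \<open>The arbitrary \<open>\<Delta>\<close>, here and in later cases, absorbs the
    principal formulas that the cumulative right rules leave behind.\<close>
  have "derivable {(\<alpha>, At k (Box (\<sigma> p))), (\<alpha>, At k (Box (\<sigma> p \<^bold>\<rightarrow> \<sigma> q)))}
      (insert (Child \<alpha> k i) T) (insert (Child \<alpha> k i, At k (\<sigma> q)) \<Delta>)" for i \<Delta>
    apply (rule derivable_BoxL[of \<alpha> k "\<sigma> p" _ i]; simp?)
    apply (rule derivable_BoxL[of \<alpha> k "\<sigma> p \<^bold>\<rightarrow> \<sigma> q" _ i]; simp?)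
    by (rule derivable_ImpL[OF insertI1 derivable_init[OF _ insertI1] derivable_init[OF insertI1]]) auto
  then show ?case
    by (auto intro!: derivable_ImpR[OF insertI1] derivable_BoxR[OF insertI1])
next
  case (K_F p q)
  have "derivable (insert (\<alpha>, At k (DiaF (Nom m)))
      {(\<alpha>, At k (F (\<sigma> p))), (\<alpha>, At k (F (\<sigma> p \<^bold>\<rightarrow> \<sigma> q)))}) T (insert (\<alpha>, At m (\<sigma> q)) \<Delta>)" for m \<Delta>
    \<comment> \<open>The eigennominal \<open>m\<close> introduced by \<open>FR\<close> is the
      witness for both uses of \<open>FL\<close>.\<close>
    apply (rule derivable_FL[of \<alpha> k "\<sigma> p" _ _ m]; simp?)
     apply (rule derivable_init[OF _ insertI1]; simp)
    apply (rule derivable_FL[of \<alpha> k "\<sigma> p \<^bold>\<rightarrow> \<sigma> q" _ _ m]; simp?)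
     apply (rule derivable_init[OF _ insertI1]; simp)
    by (rule derivable_ImpL[OF insertI1 derivable_init[OF _ insertI1] derivable_init[OF insertI1]]) auto
  then show ?case
    by (auto intro!: derivable_ImpR[OF insertI1] derivable_FR[OF insertI1])
next
  case (K_At n p q)
  have "derivable {(\<alpha>, At k (At (\<rho> n) (\<sigma> p))), (\<alpha>, At k (At (\<rho> n) (\<sigma> p \<^bold>\<rightarrow> \<sigma> q)))} T
      (insert (\<alpha>, At (\<rho> n) (\<sigma> q)) \<Delta>)" for \<Delta>
    apply (rule derivable_AtL[of \<alpha> k "\<rho> n" "\<sigma> p"]; simp?)
    apply (rule derivable_AtL[of \<alpha> k "\<rho> n" "\<sigma> p \<^bold>\<rightarrow> \<sigma> q"]; simp?)
    by (rule derivable_ImpL[OF insertI1 derivable_init[OF _ insertI1] derivable_init[OF insertI1]]) auto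
  then show ?case
    by (auto intro!: derivable_ImpR[OF insertI1] derivable_AtR[OF insertI1])
next
  case (Ref n)
  have "derivable {} T {(\<alpha>, At (\<rho> n) (Nom (\<rho> n))), (\<alpha>, At k (At (\<rho> n) (Nom (\<rho> n))))}"
    using Ref by (intro derivable_refEq[of \<alpha> "\<rho> n", OF derivable_init[OF insertI1]]) auto
  then show ?case
    by (auto intro!: derivable_AtR[OF insertI1])
next
  case (Selfdual n p)
  let ?a = "\<sigma> p" and ?n = "\<rho> n"
  have "derivable {(\<alpha>, At k (Neg (At ?n ?a)))} T {(\<alpha>, At k (At ?n (Neg ?a)))}"
    apply (rule derivable_AtR[OF insertI1])
    apply (rule derivable_ImpR[OF insertI1])
    apply (rule derivable_ImpL[of \<alpha> k "At ?n ?a" Bot]; simp?)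
     apply (rule derivable_AtR[OF insertI1])
     apply (rule derivable_init[OF _ insertI1]; simp)
    by (rule derivable_BotL[OF insertI1])
  moreover have "derivable {(\<alpha>, At k (At ?n (Neg ?a)))} T {(\<alpha>, At k (Neg (At ?n ?a)))}"
    apply (rule derivable_AtL[OF insertI1])
    apply (rule derivable_ImpR[OF insertI1])
    apply (rule derivable_AtL[OF insertI1])
    apply (rule derivable_ImpL[of \<alpha> ?n ?a Bot]; simp?)
     apply (rule derivable_init[OF _ insertI1]; simp)
    by (rule derivable_BotL[OF insertI1])
  ultimately show ?case
    by (simp add: derivable_IffR)
next
  case (Elim n p)
  have "derivable {(\<alpha>, At k (Nom (\<rho> n))), (\<alpha>, At k (At (\<rho> n) (\<sigma> p)))} T
      (insert (\<alpha>, At k (\<sigma> p)) \<Delta>)" for \<Delta>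
    apply (rule derivable_AtL[of \<alpha> k "\<rho> n" "\<sigma> p"]; simp?)
    \<comment> \<open>The antecedent says that \<open>k\<close> and \<open>\<rho> n\<close> name the
      same agent, which carries the formula over to prefix \<open>k\<close>.\<close>
    apply (rule derivable_rep[of \<alpha> k "\<rho> n" _ "\<sigma> p"]; simp?)
    by (rule derivable_init[OF _ insertI1]; simp)
  then show ?case
    by (auto intro!: derivable_ImpR[OF insertI1])
next
  case (Agree n m p)
  have "derivable {(\<alpha>, At k (At (\<rho> n) (At (\<rho> m) (\<sigma> p))))} T
      (insert (\<alpha>, At (\<rho> m) (\<sigma> p)) \<Delta>)" for \<Delta>
    apply (rule derivable_AtL[OF insertI1])
    apply (rule derivable_AtL[OF insertI1])
    by (rule derivable_init[OF _ insertI1]; simp)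
  then show ?case
    by (auto intro!: derivable_ImpR[OF insertI1] derivable_AtR[OF insertI1])
next
  case (Back n p)
  have "derivable (insert x {(\<alpha>, At k (At (\<rho> n) (\<sigma> p)))}) T
      (insert (\<alpha>, At (\<rho> n) (\<sigma> p)) \<Delta>)" for x \<Delta>
    apply (rule derivable_AtL[of \<alpha> k "\<rho> n" "\<sigma> p"]; simp?)
    by (rule derivable_init[OF _ insertI1]; simp)
  then show ?case
    by (auto intro!: derivable_ImpR[OF insertI1] derivable_FR[OF insertI1] derivable_AtR[OF insertI1])
next
  case (DCom n p)
  let ?a = "\<sigma> p" and ?n = "\<rho> n"
  \<comment> \<open>At an \<open>?n\<close>-child the boxed formula already has prefix
    \<open>?n\<close>, so the inner \<open>At ?n\<close> is absorbed there.\<close>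
  have "derivable {(\<alpha>, At k (At ?n (Box (At ?n ?a))))} T {(\<alpha>, At k (At ?n (Box ?a)))}"
    apply (rule derivable_AtL[OF insertI1])
    apply (rule derivable_AtR[OF insertI1])
    apply (rule derivable_BoxR[OF insertI1])
    apply (rule derivable_BoxL[OF insertI1])
     apply (rule derivable_AtL[OF insertI1])
     apply (rule derivable_init[OF insertI1])
    by auto
  moreover have "derivable {(\<alpha>, At k (At ?n (Box ?a)))} T {(\<alpha>, At k (At ?n (Box (At ?n ?a))))}"
    apply (rule derivable_AtL[OF insertI1])
    apply (rule derivable_AtR[OF insertI1])
    apply (rule derivable_BoxR[OF insertI1])
    apply (rule derivable_BoxL[OF insertI1])
     apply (rule derivable_AtR[OF insertI1])
     apply (rule derivable_init[OF _ insertI1])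
    by auto
  ultimately show ?case
    by (simp add: derivable_IffR)
next
  case (Rigid_eq n m)
  have "derivable {(\<alpha>, At k (At (\<rho> n) (Nom (\<rho> m))))} (insert (Child \<alpha> k i) T)
      (insert (Child \<alpha> k i, At (\<rho> n) (Nom (\<rho> m))) \<Delta>)" for i \<Delta>
    apply (rule derivable_AtL[OF insertI1])
    apply (rule derivable_rigidEq[OF insertI1, where \<beta> = "Child \<alpha> k i"]; simp?)
    by (rule derivable_init[OF _ insertI1]; simp)
  then show ?case
    by (auto intro!: derivable_ImpR[OF insertI1] derivable_BoxR[OF insertI1] derivable_AtR[OF insertI1])
next
  case (Rigid_neq n m)
  have "derivable {(Child \<alpha> k i, At k (At (\<rho> n) (Nom (\<rho> m)))),
      (\<alpha>, At k (Neg (At (\<rho> n) (Nom (\<rho> m)))))} (insert (Child \<alpha> k i) T) \<Delta>" for i \<Delta>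
    apply (rule derivable_ImpL[of \<alpha> k "At (\<rho> n) (Nom (\<rho> m))" Bot]; simp?)
     apply (rule derivable_AtR[OF insertI1])
     apply (rule derivable_AtL[OF insertI1])
     \<comment> \<open>The equation travels from the child back to the parent, where its negation
       was assumed.\<close>
     apply (rule derivable_rigidEq[OF insertI1, where \<beta> = \<alpha>])
      apply (rule derivable_init[OF insertI1])
      apply (use Rigid_neq in auto)[2]
    by (rule derivable_BotL[OF insertI1])
  then show ?case
    by (auto intro!: derivable_ImpR[OF insertI1] derivable_BoxR[OF insertI1])
next
  case (MP \<phi> \<psi>)
  let ?\<phi> = "usubst \<sigma> \<rho> \<phi>" and ?\<psi> = "usubst \<sigma> \<rho> \<psi>"
  have "derivable {(\<alpha>, At k ?\<phi>)} T {(\<alpha>, At k ?\<psi>)}"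
    using derivable_ImpR_inv[of "{}" T \<alpha> k ?\<phi> ?\<psi> "{}"] MP by simp
  moreover have "derivable {} T {(\<alpha>, At k ?\<phi>), (\<alpha>, At k ?\<psi>)}"
    using MP by (intro derivable_weaken[OF MP.IH(2)]) auto
  ultimately show ?case
    using derivable_cut[OF _ _ MP.prems(3)] by simp
next
  case (Nec_Box \<phi>)
  then show ?case
    by (simp add: derivable_BoxR_elim is_tree_insert_Child)
next
  case (Nec_F \<phi>)
  show ?case
    unfolding usubst.simps
  proof (rule derivable_FR[OF insertI1])
    fix m
    show "derivable {(\<alpha>, At k (DiaF (Nom m)))} T
        {(\<alpha>, At m (usubst \<sigma> \<rho> \<phi>)), (\<alpha>, At k (F (usubst \<sigma> \<rho> \<phi>)))}"
      using Nec_F.prems by (intro derivable_weaken[OF Nec_F.IH[of T \<alpha> m \<sigma> \<rho>]]) auto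
  qed
next
  case (Nec_At \<phi> n)
  show ?case
    unfolding usubst.simps
  proof (rule derivable_AtR[OF insertI1])
    show "derivable {} T {(\<alpha>, At (\<rho> n) (usubst \<sigma> \<rho> \<phi>)), (\<alpha>, At k (At (\<rho> n) (usubst \<sigma> \<rho> \<phi>)))}"
      using Nec_At.prems by (intro derivable_weaken[OF Nec_At.IH[of T \<alpha> "\<rho> n" \<sigma> \<rho>]]) auto
  qed
next
  case (USubst \<phi> \<sigma>' \<rho>')
  then show ?case
    by (simp add: usubst_usubst)
next
  case (Name n \<phi>)
  have "derivable {} T {(\<alpha>, At k (Nom k \<^bold>\<rightarrow> usubst \<sigma> \<rho> \<phi>))}"
    using Name.IH[OF Name.prems, of k \<sigma> "\<rho>(n := k)"]
    unfolding usubst.simps usubst_fresh[OF Name.hyps(2)] by simp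
  then show ?case
    \<comment> \<open>Inversion leaves \<open>At k (Nom k)\<close> on the left, and
      \<open>RefEq\<close> discharges it.\<close>
    by (rule derivable_refEq[OF derivable_ImpR_inv]) (use Name.prems in auto)
next
  case (LBG L n m \<phi>)
  let ?C = "usubst \<sigma> \<rho> (plug L (At n (F \<phi>)))"
  have ts: "tree_sequent {} T {(\<alpha>, At k ?C)}"
    using LBG.prems by (simp add: tree_sequent_def)
  \<comment> \<open>The original \<open>m\<close> is fresh only for the Hilbert conclusion; it may
    occur in \<open>T\<close>, in \<open>k\<close> or in values of the substitution.\<close>
  then obtain m' where m': "m' \<notin> seq_noms {} T {(\<alpha>, At k ?C)}"
    using ex_fresh_nominal[OF finite_seq_noms] by metis
  have m: "m \<noteq> n" "m \<notin> noms \<phi>"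
    using LBG.hyps(2) noms_plug_hole[of "At n (F \<phi>)" L] by auto
  have "derivable {} T {(\<alpha>, At k (plug (usubst_nform \<sigma> \<rho> L)
      (At (\<rho> n) (DiaF (Nom m')) \<^bold>\<rightarrow> At m' (usubst \<sigma> \<rho> \<phi>))))}"
    using LBG.IH[OF LBG.prems, of k \<sigma> "\<rho>(m := m')"] m(1)
    unfolding usubst_plug usubst_nform_fresh[OF LBG.hyps(2)] usubst.simps usubst_fresh[OF m(2)]
    by simp
  then show ?case
    using derivable_plug_F[of "{}" T \<alpha> k "usubst_nform \<sigma> \<rho> L" "\<rho> n" m' "usubst \<sigma> \<rho> \<phi>" "{}"] ts m'
    by (simp add: usubst_plug)
qed

theorem theorem4:
  fixes \<phi> :: fm and T :: "label set" and \<alpha> :: label and n :: nominal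
  assumes "HEFL \<phi>"
    and "finite T" and "is_tree T" and "\<alpha> \<in> T"
    and "n \<notin> noms \<phi>"
  shows "TEFL {} T {(\<alpha>, At n \<phi>)}"
proof -
  have "tree_sequent {} T {(\<alpha>, At n \<phi>)}"
    using assms by (simp add: tree_sequent_def)
  then show ?thesis
    using HEFL_derivable[OF assms(1-4), of n Var id] by (simp add: usubst_Var_id derivable_def)
qed

end
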